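(* Fix an integer $m\geq 2$ and a real $q>1$, and consider the family of one-step transition distributions $\{\Lambda(m,y,q)\}_{y\in\mathbb{R}}$. Then: (i) For every integer $k\geq 1$, the family $\{\Lambda(km-k+1,y,q)\}_{y\in\mathbb{R}}$ is the family of $k$-step distributions, i.e. the $k$-fold composition of the transition kernel $y\mapsto\Lambda(m,y,q)$ with itself: if $z_0=y$ and, successively for $l=1,\ldots,k$, $z_l$ is selected at random according to $\Lambda(m,z_{l-1},q)$, then $z_k$ has distribution $\Lambda(km-k+1,y,q)$. (ii) For all integers $k,j\geq 1$ and every $x\in\mathbb{R}$: if $y$ is selected according to $\Lambda(km-k+1,x,q)$ and then, given $y$, $z$ is selected according to $\Lambda(jm-j+1,y,q)$, then $z$ has distribution $\Lambda((k+j)m-(k+j)+1,x,q)$.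
   Context: Let $q>1$. Put $[0]_q=0$, $[n]_q=1+q+\cdots+q^{n-1}$ for $n\ge 1$. Al-Salam-Chihara polynomials: $p_{-1}=0$, $p_0=1$, and for $n\ge 0$ $$p_{n+1}(x|y,\rho,q)=(x-\rho yq^{n})p_n(x|y,\rho,q)-(1-\rho^2q^{n-1})[n]_q\,p_{n-1}(x|y,\rho,q).$$ For $t\in\mathbb{R}$ and $n\in\mathbb{Z}$ put $$\chi_n(t,q)=t\,\frac{q^{n/2}+q^{-n/2}}{2}+\sqrt{t^2+\frac{4}{q-1}}\;\frac{q^{n/2}-q^{-n/2}}{2}$$ (so $\chi_0(t,q)=t$). For an integer $m\ge 1$ let $(\mathbf{m})=\{-(m-1),-(m-3),\ldots,m-3,m-1\}$ (the $m$ integers between $-(m-1)$ and $m-1$ having the parity of $m-1$; in particular $(\mathbf{1})=\{0\}$), and let $\mathbf{S}_m(y,q)=\{\chi_k(y,q):k\in(\mathbf{m})\}$. $\Lambda(m,y,q)$, for $y\in\mathbb{R}$, is the discrete probability distribution on $\mathbf{S}_m(y,q)$ whose masses $\lambda_{i,m}(y,q)$, at the points $\chi_i(y,q)$, $i\in(\mathbf{m})$, are given by the unique solution of the linear system $$\sum_{i\in(\mathbf{m})}\lambda_{i,m}(y,q)=1,\qquad \sum_{i\in(\mathbf{m})}\lambda_{i,m}(y,q)\,p_j\bigl(\chi_i(y,q)\,\big|\,y,q^{-(m-1)/2},q\bigr)=0,\quad j=1,\ldots,m-1.$$ *)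

theory Defs
  imports "HOL-Probability.Probability_Mass_Function"
begin

definition q_bracket :: "nat \<Rightarrow> real \<Rightarrow> real" where
  "q_bracket n q = (\<Sum>i<n. q ^ i)"

text \<open>
  Al-Salam--Chihara polynomials \<open>p\<^sub>n(x|y,\<rho>,q)\<close>. The second equation is the instance
  \<open>n = 0\<close> of the three-term recurrence, whose last term vanishes as \<open>p\<^sub>-\<^sub>1 = 0\<close>.
\<close>
fun asc_poly :: "nat \<Rightarrow> real \<Rightarrow> real \<Rightarrow> real \<Rightarrow> real \<Rightarrow> real" where
  "asc_poly 0 x y \<rho> q = 1"
| "asc_poly (Suc 0) x y \<rho> q = x - \<rho> * y"
| "asc_poly (Suc (Suc n)) x y \<rho> q =
     (x - \<rho> * y * q ^ Suc n) * asc_poly (Suc n) x y \<rho> q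
     - (1 - \<rho>\<^sup>2 * q ^ n) * q_bracket (Suc n) q * asc_poly n x y \<rho> q"

definition chi :: "int \<Rightarrow> real \<Rightarrow> real \<Rightarrow> real" where
  "chi n t q =
     t * ((q powr (real_of_int n / 2) + q powr (- real_of_int n / 2)) / 2)
     + sqrt (t\<^sup>2 + 4 / (q - 1)) * ((q powr (real_of_int n / 2) - q powr (- real_of_int n / 2)) / 2)"

definition index_set :: "nat \<Rightarrow> int set" where
  "index_set m = {i. \<bar>i\<bar> \<le> int m - 1 \<and> even (i - (int m - 1))}"

text \<open>
  The linear system determining the masses. As functions in HOL are total, the masses are
  required to vanish off the index set, so that the solution is unique as a function.
\<close>
definition mass_system :: "nat \<Rightarrow> real \<Rightarrow> real \<Rightarrow> (int \<Rightarrow> real) \<Rightarrow> bool" where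
  "mass_system m y q l \<longleftrightarrow>
     (\<forall>i. i \<notin> index_set m \<longrightarrow> l i = 0) \<and>
     (\<Sum>i\<in>index_set m. l i) = 1 \<and>
     (\<forall>j\<in>{1..m - 1}.
        (\<Sum>i\<in>index_set m. l i * asc_poly j (chi i y q) y (q powr (- (real m - 1) / 2)) q) = 0)"

definition mass :: "nat \<Rightarrow> real \<Rightarrow> real \<Rightarrow> int \<Rightarrow> real" where
  "mass m y q = (THE l. mass_system m y q l)"

text \<open>
  \<open>\<Lambda>(m,y,q)\<close> puts mass \<open>\<lambda>\<^sub>i\<^sub>,\<^sub>m(y,q)\<close> at the point \<open>\<chi>\<^sub>i(y,q)\<close>: it is the image under
  \<open>i \<mapsto> \<chi>\<^sub>i(y,q)\<close> of the distribution on the index set with these masses.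
  For \<open>q > 1\<close> and \<open>m \<ge> 1\<close> the linear system has exactly one solution and it is nonnegative,
  so that neither \<^const>\<open>The\<close> nor \<^const>\<open>embed_pmf\<close> is used outside its domain.
\<close>
definition Lambda :: "nat \<Rightarrow> real \<Rightarrow> real \<Rightarrow> real pmf" where
  "Lambda m y q = map_pmf (\<lambda>i. chi i y q) (embed_pmf (mass m y q))"

text \<open>Distribution of \<open>z\<^sub>k\<close> when \<open>z\<^sub>0 = y\<close> and each \<open>z\<^sub>l\<^sub>+\<^sub>1\<close> is drawn from \<open>K z\<^sub>l\<close>.\<close>
primrec step_pmf :: "('a \<Rightarrow> 'a pmf) \<Rightarrow> nat \<Rightarrow> 'a \<Rightarrow> 'a pmf" where
  "step_pmf K 0 y = return_pmf y"
| "step_pmf K (Suc l) y = bind_pmf (step_pmf K l y) K"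

end

theory Submission
  imports Defs "HOL-Computational_Algebra.Polynomial"
begin

text \<open>
  Write \<open>y = (u - 1/u) / sqrt (q - 1)\<close> with \<open>u > 0\<close>. Then \<open>\<chi>\<^sub>i\<close> multiplies \<open>u\<close> by \<open>q\<^bsup>i/2\<^esup>\<close>, so that
  \<open>\<chi>\<^sub>i \<circ> \<chi>\<^sub>j = \<chi>\<^sub>i\<^sub>+\<^sub>j\<close>, and \<open>\<Lambda>(2,y,q)\<close> is one step of a nearest-neighbour walk on the indices, going up
  with probability \<open>1 / (1 + u\<^sup>2)\<close>. One step maps the \<open>q\<close>-Hermite polynomial \<open>H\<^sub>k\<close> to
  \<open>q\<^bsup>-k/2\<^esup> H\<^sub>k\<close>. Since \<open>p\<^sub>n(x|y,\<rho>,q) = \<Sum>\<^sub>k c\<^sub>n\<^sub>,\<^sub>k(y) \<rho>\<^bsup>n-k\<^esup> H\<^sub>k(x)\<close> with \<open>c\<^sub>n\<^sub>,\<^sub>k\<close> not depending on \<open>\<rho>\<close>,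
  the expectation of \<open>p\<^sub>n(\<cdot>|y,q\<^bsup>-N/2\<^esup>,q)\<close> after \<open>N\<close> steps is \<open>q\<^bsup>-nN/2\<^esup> p\<^sub>n(y|y,1,q)\<close>, which vanishes for
  \<open>n \<ge> 1\<close>. Hence \<open>\<Lambda>(N + 1,y,q)\<close> is the \<open>N\<close>-step distribution of this one walk, for every \<open>N\<close>,
  and both claims reduce to the Chapman--Kolmogorov equations.
\<close>

subsection \<open>Composition of kernels\<close>

lemma step_pmf_add:
  "step_pmf K (a + b) y = bind_pmf (step_pmf K a y) (step_pmf K b)"
proof (induction b)
  case 0
  have "step_pmf K 0 = return_pmf" by (simp add: fun_eq_iff)
  then show ?case by (simp add: bind_return_pmf')
next
  case (Suc b)
  then show ?case by (simp add: bind_assoc_pmf)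
qed

lemma step_pmf_mult: "step_pmf (step_pmf K a) b y = step_pmf K (b * a) y"
proof (induction b)
  case (Suc b)
  have "step_pmf K (Suc b * a) y = step_pmf K (b * a + a) y"
    by (simp add: add.commute)
  then show ?case
    using Suc by (simp only: step_pmf_add step_pmf.simps)
qed simp

subsection \<open>The multiplicative parametrisation\<close>

text \<open>The square root is rational in \<open>u\<close> because
  \<open>(u - 1/u)^2 + 4 = (u + 1/u)^2\<close>; the two halves of \<open>chi\<close> then recombine
  into a rescaling of \<open>u\<close>.\<close>

lemma chi_param:
  assumes "q > 1" "u > 0"
  shows "chi n ((u - 1 / u) / sqrt (q - 1)) q
    = (u * q powr (n / 2) - 1 / (u * q powr (n / 2))) / sqrt (q - 1)"
    and sqrt_param: "sqrt (((u - 1 / u) / sqrt (q - 1))\<^sup>2 + 4 / (q - 1)) = (u + 1 / u) / sqrt (q - 1)"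
proof -
  have "((u - 1 / u) / sqrt (q - 1))\<^sup>2 + 4 / (q - 1) = ((u + 1 / u) / sqrt (q - 1))\<^sup>2"
  proof -
    have "(u - 1 / u)\<^sup>2 + 4 = (u + 1 / u)\<^sup>2"
      using assms by (simp add: power2_eq_square algebra_simps)
    then show ?thesis
      using assms by (simp add: power_divide add_divide_distrib[symmetric])
  qed
  then show s: "sqrt (((u - 1 / u) / sqrt (q - 1))\<^sup>2 + 4 / (q - 1)) = (u + 1 / u) / sqrt (q - 1)"
    using assms by simp
  show "chi n ((u - 1 / u) / sqrt (q - 1)) q
    = (u * q powr (n / 2) - 1 / (u * q powr (n / 2))) / sqrt (q - 1)"
    unfolding chi_def s using assms by (simp add: powr_minus field_simps)
qed

lemma param_exists:
  assumes "q > 1"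
  obtains u where "u > 0" "y = (u - 1 / u) / sqrt (q - 1)"
proof
  define z where "z = y * sqrt (q - 1)"
  \<comment> \<open>The positive root of \<open>u^2 - z u - 1 = 0\<close>.\<close>
  define u where "u = (z + sqrt (z\<^sup>2 + 4)) / 2"
  have "- z < sqrt (z\<^sup>2 + 4)"
    by (rule real_less_rsqrt) simp
  then show pos: "u > 0" unfolding u_def by simp
  have "u * u - 1 = z * u"
    unfolding u_def by (simp add: field_simps power2_eq_square)
  then have "u - 1 / u = z"
    using pos by (simp add: field_simps)
  then show "y = (u - 1 / u) / sqrt (q - 1)"
    using assms by (simp add: z_def)
qed

lemma chi_chi:
  assumes "q > 1"
  shows "chi i (chi j y q) q = chi (i + j) y q"
proof -
  obtain u where u: "u > 0" "y = (u - 1 / u) / sqrt (q - 1)"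
    using param_exists[OF assms] by blast
  have "u * q powr (j / 2) > 0" using u assms by simp
  from chi_param(1)[OF assms this, of i] chi_param(1)[OF assms u(1), of j]
    chi_param(1)[OF assms u(1), of "i + j"]
  show ?thesis
    by (simp add: u(2) add_divide_distrib powr_add mult_ac)
qed

lemma chi_0 [simp]: "q > 1 \<Longrightarrow> chi 0 y q = y"
  by (simp add: chi_def)

lemma diff_inverse_inj:
  fixes a b :: real
  assumes "a > 0" "b > 0" "a - 1 / a = b - 1 / b"
  shows "a = b"
proof -
  have "(a - b) * (a * b + 1) = 0"
    using assms by (simp add: field_simps)
  moreover have "a * b + 1 > 0" using assms by (simp add: add_pos_pos)
  ultimately show ?thesis by simp
qed

lemma inj_chi:
  assumes "q > 1"
  shows "inj (\<lambda>i. chi i y q)"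
proof (rule injI)
  fix i j assume eq: "chi i y q = chi j y q"
  obtain u where u: "u > 0" "y = (u - 1 / u) / sqrt (q - 1)"
    using param_exists[OF assms] by blast
  have "u * q powr (i / 2) = u * q powr (j / 2)"
  proof (rule diff_inverse_inj)
    show "u * q powr (i / 2) - 1 / (u * q powr (i / 2))
        = u * q powr (j / 2) - 1 / (u * q powr (j / 2))"
      using eq assms unfolding u(2) chi_param(1)[OF assms u(1)] divide_cancel_right by simp
  qed (use assms u(1) in simp_all)
  then show "i = j" using assms u(1) by (simp add: powr_inj)
qed

subsection \<open>q-Hermite polynomials and the expansion of the Al-Salam--Chihara polynomials\<close>

lemma q_bracket_0 [simp]: "q_bracket 0 q = 0"
  by (simp add: q_bracket_def)

lemma q_bracket_Suc: "q_bracket (Suc n) q = 1 + q * q_bracket n q"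
  unfolding q_bracket_def sum.lessThan_Suc_shift by (simp add: sum_distrib_left)

definition q_hermite :: "nat \<Rightarrow> real \<Rightarrow> real \<Rightarrow> real" where
  "q_hermite n x q = asc_poly n x 0 0 q"

lemma q_hermite_0 [simp]: "q_hermite 0 x q = 1"
  by (simp add: q_hermite_def)

text \<open>At \<open>n = 0\<close> the truncated index \<open>n - 1\<close> is harmless:
  \<open>q_bracket 0 q = 0\<close> annihilates that term.\<close>

lemma q_hermite_Suc:
  "q_hermite (Suc n) x q = x * q_hermite n x q - q_bracket n q * q_hermite (n - 1) x q"
  by (cases n) (simp_all add: q_hermite_def)

text \<open>Found by inserting an expansion in \<open>\<rho> ^ (n - k) * q_hermite k x q\<close>
  into the three-term recurrence. Of its last term only the part with \<open>\<rho>^2\<close>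
  survives; the rest cancels against the lowering part of
  \<open>x * q_hermite k x q\<close>.\<close>

fun asc_coeff :: "nat \<Rightarrow> nat \<Rightarrow> real \<Rightarrow> real \<Rightarrow> real" where
  "asc_coeff 0 k y q = (if k = 0 then 1 else 0)"
| "asc_coeff (Suc 0) k y q = (if k = 0 then - y else if k = 1 then 1 else 0)"
| "asc_coeff (Suc (Suc n)) k y q =
     (if k = 0 then 0 else asc_coeff (Suc n) (k - 1) y q)
     - y * q ^ Suc n * asc_coeff (Suc n) k y q
     + q ^ n * q_bracket (Suc n) q * asc_coeff n k y q"

lemma asc_coeff_eq_0: "n < k \<Longrightarrow> asc_coeff n k y q = 0"
  by (induction n k y q rule: asc_coeff.induct) auto

text \<open>Cleared of denominators: \<open>asc_coeff n k\<close> is a Gaussian binomial times a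
  function of \<open>n - k\<close>. This supplies the cancellation that keeps the coefficients free
  of \<open>\<rho>\<close>.\<close>

lemma asc_coeff_Suc_Suc:
  "q_bracket (Suc k) q * asc_coeff (Suc n) (Suc k) y q = q_bracket (Suc n) q * asc_coeff n k y q"
proof (induction n arbitrary: k rule: less_induct)
  case (less n)
  consider "n = 0" | "n = 1" | n' where "n = Suc (Suc n')"
    by (metis One_nat_def not0_implies_Suc)
  then show ?case
  proof cases
    case 1
    then show ?thesis by simp
  next
    case 2
    then show ?thesis
      by (cases k) (auto simp: q_bracket_Suc algebra_simps split: if_splits)
  next
    case 3
    let ?c = "\<lambda>n k. asc_coeff n k y q" and ?b = "\<lambda>n. q_bracket n q"
    have IH1: "?b (Suc k) * ?c n (Suc k) = ?b n * ?c (Suc n') k"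
      using less.IH[of "Suc n'" k] 3 by simp
    have IH2: "?b (Suc k) * ?c (Suc n') (Suc k) = ?b (Suc n') * ?c n' k"
      using less.IH[of n' k] 3 by simp
    have IH3: "(if k = 0 then 0 else ?b k * ?c n k)
        = ?b n * (if k = 0 then 0 else ?c (Suc n') (k - 1))"
      using less.IH[of "Suc n'" "k - 1"] 3 by (cases k) (auto simp del: asc_coeff.simps)
    have rec: "?c n k = (if k = 0 then 0 else ?c (Suc n') (k - 1))
        - y * q ^ Suc n' * ?c (Suc n') k + q ^ n' * ?b (Suc n') * ?c n' k"
      using 3 by simp
    have "?b (Suc k) * ?c (Suc n) (Suc k) = ?b (Suc k) * ?c n k
        - y * q ^ n * (?b (Suc k) * ?c n (Suc k))
        + q ^ Suc n' * ?b n * (?b (Suc k) * ?c (Suc n') (Suc k))"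
      using 3 by (simp add: algebra_simps)
    also have "\<dots> = ?b (Suc k) * ?c n k + q * ?b n *
        (- y * q ^ Suc n' * ?c (Suc n') k + q ^ n' * ?b (Suc n') * ?c n' k)"
      unfolding IH1 IH2 using 3 by (simp add: algebra_simps)
    \<comment> \<open>By \<open>rec\<close>, the parenthesis is \<open>?c n k\<close> without its
      raising term. \<open>IH3\<close> then trades that term for \<open>?b k * ?c n k\<close>, and
      \<open>[k+1] - q [k] = 1\<close>.\<close>
    also have "\<dots> = ?b (Suc k) * ?c n k + q * ?b n * ?c n k
        - q * (?b n * (if k = 0 then 0 else ?c (Suc n') (k - 1)))"
      unfolding rec by (simp only: algebra_simps)
    also have "\<dots> = ?b (Suc k) * ?c n k + q * ?b n * ?c n k - q * (?b k * ?c n k)"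
      unfolding IH3[symmetric] by simp
    also have "\<dots> = ?b (Suc n) * ?c n k"
      by (simp add: q_bracket_Suc algebra_simps)
    finally show ?thesis .
  qed
qed

lemma asc_poly_expansion:
  "asc_poly n x y \<rho> q = (\<Sum>k\<le>n. asc_coeff n k y q * \<rho> ^ (n - k) * q_hermite k x q)"
proof (induction n rule: less_induct)
  case (less n)
  consider "n = 0" | "n = 1" | n' where "n = Suc (Suc n')"
    by (metis One_nat_def not0_implies_Suc)
  then show ?case
  proof cases
    case 1
    then show ?thesis by simp
  next
    case 2
    then show ?thesis by (simp add: q_hermite_Suc)
  next
    case 3
    let ?m = "Suc n'"
    let ?c = "\<lambda>n k. asc_coeff n k y q" and ?b = "\<lambda>n. q_bracket n q" and ?h = "\<lambda>k. q_hermite k x q"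
    have p1: "asc_poly ?m x y \<rho> q = (\<Sum>k\<le>?m. ?c ?m k * \<rho> ^ (?m - k) * ?h k)"
      and p0: "asc_poly n' x y \<rho> q = (\<Sum>k\<le>n'. ?c n' k * \<rho> ^ (n' - k) * ?h k)"
      using less.IH 3 by auto
    \<comment> \<open>As \<open>x H_k = H_(k+1) + [k] H_(k-1)\<close>, this sum collects the
      lowering parts arising from \<open>x * asc_poly ?m x y \<rho> q\<close>.\<close>
    have "(\<Sum>k\<le>?m. ?c ?m k * \<rho> ^ (?m - k) * (?b k * ?h (k - 1)))
        = (\<Sum>k\<le>n'. (?b (Suc k) * ?c ?m (Suc k)) * \<rho> ^ (n' - k) * ?h k)"
      by (subst sum.atMost_Suc_shift) (simp add: mult_ac)
    also have "\<dots> = ?b ?m * asc_poly n' x y \<rho> q"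
      unfolding asc_coeff_Suc_Suc p0 by (simp add: sum_distrib_left mult_ac)
    finally have lower: "(\<Sum>k\<le>?m. ?c ?m k * \<rho> ^ (?m - k) * (?b k * ?h (k - 1)))
        = ?b ?m * asc_poly n' x y \<rho> q" .
    have s1: "(\<Sum>k\<le>n. (if k = 0 then 0 else ?c ?m (k - 1)) * \<rho> ^ (n - k) * ?h k)
        = x * asc_poly ?m x y \<rho> q - ?b ?m * asc_poly n' x y \<rho> q"
    proof -
      have "(\<Sum>k\<le>n. (if k = 0 then 0 else ?c ?m (k - 1)) * \<rho> ^ (n - k) * ?h k)
          = (\<Sum>k\<le>?m. ?c ?m k * \<rho> ^ (?m - k) * ?h (Suc k))"
        unfolding 3 by (subst sum.atMost_Suc_shift) simp
      also have "\<dots> = x * asc_poly ?m x y \<rho> q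
          - (\<Sum>k\<le>?m. ?c ?m k * \<rho> ^ (?m - k) * (?b k * ?h (k - 1)))"
        unfolding p1 q_hermite_Suc
        by (simp only: sum_distrib_left right_diff_distrib sum_subtractf mult_ac)
      finally show ?thesis unfolding lower .
    qed
    \<comment> \<open>The top coefficient vanishes; on the remaining indices \<open>n - k\<close>
      exceeds \<open>?m - k\<close> by exactly one despite truncated subtraction, so one factor
      \<open>\<rho>\<close> comes out. \<open>s3\<close> extracts two in the same way.\<close>
    have s2: "(\<Sum>k\<le>n. ?c ?m k * \<rho> ^ (n - k) * ?h k) = \<rho> * asc_poly ?m x y \<rho> q"
    proof -
      have "(\<Sum>k\<le>n. ?c ?m k * \<rho> ^ (n - k) * ?h k) = (\<Sum>k\<le>?m. ?c ?m k * \<rho> ^ (n - k) * ?h k)"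
        unfolding 3 by (simp add: asc_coeff_eq_0 del: asc_coeff.simps)
      also have "\<dots> = (\<Sum>k\<le>?m. \<rho> * (?c ?m k * \<rho> ^ (?m - k) * ?h k))"
        unfolding 3 by (intro sum.cong) (auto simp: Suc_diff_le simp del: asc_coeff.simps)
      finally show ?thesis unfolding p1 sum_distrib_left .
    qed
    have s3: "(\<Sum>k\<le>n. ?c n' k * \<rho> ^ (n - k) * ?h k) = \<rho>\<^sup>2 * asc_poly n' x y \<rho> q"
    proof -
      have "(\<Sum>k\<le>n. ?c n' k * \<rho> ^ (n - k) * ?h k) = (\<Sum>k\<le>n'. ?c n' k * \<rho> ^ (n - k) * ?h k)"
        unfolding 3 by (simp add: asc_coeff_eq_0 del: asc_coeff.simps)
      also have "\<dots> = (\<Sum>k\<le>n'. \<rho>\<^sup>2 * (?c n' k * \<rho> ^ (n' - k) * ?h k))"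
        unfolding 3
        by (intro sum.cong) (auto simp: Suc_diff_le power2_eq_square simp del: asc_coeff.simps)
      finally show ?thesis unfolding p0 sum_distrib_left .
    qed
    have "(\<Sum>k\<le>n. ?c n k * \<rho> ^ (n - k) * ?h k) =
        (\<Sum>k\<le>n. (if k = 0 then 0 else ?c ?m (k - 1)) * \<rho> ^ (n - k) * ?h k
          - y * q ^ ?m * (?c ?m k * \<rho> ^ (n - k) * ?h k)
          + q ^ n' * ?b ?m * (?c n' k * \<rho> ^ (n - k) * ?h k))"
      unfolding 3 asc_coeff.simps(3) by (intro sum.cong refl) (simp only: algebra_simps)
    also have "\<dots> = x * asc_poly ?m x y \<rho> q - ?b ?m * asc_poly n' x y \<rho> q
        - y * q ^ ?m * (\<rho> * asc_poly ?m x y \<rho> q)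
        + q ^ n' * ?b ?m * (\<rho>\<^sup>2 * asc_poly n' x y \<rho> q)"
      unfolding sum.distrib sum_subtractf s1 sum_distrib_left[symmetric] s2 s3 ..
    also have "\<dots> = asc_poly n x y \<rho> q"
      unfolding 3 asc_poly.simps(3) by (simp only: algebra_simps)
    finally show ?thesis by simp
  qed
qed

text \<open>On the diagonal \<open>p_1 = 0\<close>, and in \<open>p_2\<close> the factor
  \<open>1 - \<rho>^2 q^0\<close> is zero and cuts off \<open>p_0 = 1\<close>. From then on both
  predecessors vanish.\<close>

lemma asc_poly_diagonal: "n \<ge> 1 \<Longrightarrow> asc_poly n y y 1 q = 0"
proof (induction n rule: less_induct)
  case (less n)
  consider "n = 1" | "n = 2" | k where "n = Suc (Suc (Suc k))"
    using less.prems by (metis One_nat_def Suc_1 not0_implies_Suc not_one_le_zero)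
  then show ?case
  proof cases
    case 3
    then show ?thesis using less.IH[of "Suc (Suc k)"] less.IH[of "Suc k"] by simp
  qed (simp_all add: numeral_2_eq_2)
qed

subsection \<open>The nearest-neighbour walk\<close>

text \<open>For \<open>q > 1\<close>, this is the mass of \<open>Lambda 2 y q\<close> at
  \<open>chi 1 y q\<close>, written without choosing \<open>u\<close>.\<close>

definition up_prob :: "real \<Rightarrow> real \<Rightarrow> real" where
  "up_prob y q = (1 - y / sqrt (y\<^sup>2 + 4 / (q - 1))) / 2"

definition chi_walk :: "real \<Rightarrow> real \<Rightarrow> real pmf" where
  "chi_walk q y = map_pmf (\<lambda>b. chi (if b then 1 else -1) y q) (bernoulli_pmf (up_prob y q))"

text \<open>The walk is lifted to indices because \<open>mass\<close> is a function of the index,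
  not of the point; the bias is read off at the current point \<open>chi i y q\<close>.\<close>

primrec index_walk :: "nat \<Rightarrow> real \<Rightarrow> real \<Rightarrow> int pmf" where
  "index_walk 0 y q = return_pmf 0"
| "index_walk (Suc n) y q = bind_pmf (index_walk n y q)
     (\<lambda>i. map_pmf (\<lambda>b. i + (if b then 1 else -1)) (bernoulli_pmf (up_prob (chi i y q) q)))"

lemma up_prob_param:
  assumes "q > 1" "u > 0"
  shows "up_prob ((u - 1 / u) / sqrt (q - 1)) q = 1 / (1 + u\<^sup>2)"
proof -
  have "sqrt (q - 1) > 0" "u + 1 / u > 0" using assms by (auto intro: add_pos_pos)
  then have "up_prob ((u - 1 / u) / sqrt (q - 1)) q = (1 - (u - 1 / u) / (u + 1 / u)) / 2"
    unfolding up_prob_def sqrt_param[OF assms] using assms(1) by simp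
  also have "(u - 1 / u) / (u + 1 / u) = (u\<^sup>2 - 1) / (u\<^sup>2 + 1)"
    using assms(2) by (simp add: divide_simps power2_eq_square)
  also have "(1 - (u\<^sup>2 - 1) / (u\<^sup>2 + 1)) / 2 = 1 / (1 + u\<^sup>2)"
  proof -
    have "u\<^sup>2 + 1 \<noteq> 0" by (simp add: add_nonneg_eq_0_iff)
    then show ?thesis by (simp add: field_simps)
  qed
  finally show ?thesis .
qed

lemma up_prob_bounds:
  assumes "q > 1"
  shows "0 \<le> up_prob y q" "up_prob y q \<le> 1"
proof -
  obtain u where "u > 0" "y = (u - 1 / u) / sqrt (q - 1)"
    using param_exists[OF assms] by blast
  then show "0 \<le> up_prob y q" "up_prob y q \<le> 1"
    using up_prob_param[OF assms] by (simp_all add: divide_le_eq_1 add_pos_nonneg)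
qed

lemma step_chi_walk:
  assumes "q > 1"
  shows "step_pmf (chi_walk q) n y = map_pmf (\<lambda>i. chi i y q) (index_walk n y q)"
proof (induction n)
  case 0
  then show ?case using assms by simp
next
  case (Suc n)
  have "chi_walk q (chi i y q) = map_pmf (\<lambda>b. chi (i + (if b then 1 else -1)) y q)
      (bernoulli_pmf (up_prob (chi i y q) q))" for i
    unfolding chi_walk_def chi_chi[OF assms] by (simp add: add.commute)
  then show ?case
    by (simp add: Suc bind_map_pmf map_bind_pmf map_pmf_comp)
qed

lemma set_index_walk: "set_pmf (index_walk n y q) \<subseteq> index_set (Suc n)"
proof (induction n)
  case 0
  then show ?case by (simp add: index_set_def)
next
  case (Suc n)
  then show ?case
    by (fastforce simp: index_set_def split: if_splits)
qed

text \<open>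
  Up to the factor \<open>1 + u\<^sup>2\<close>, the first equation is the action of one step of the walk on \<open>H\<^sub>k\<close>; the
  second one, an Askey--Wilson type divided difference, is needed to close the induction.
\<close>
lemma q_hermite_step_aux:
  fixes c s u :: real and x :: "real \<Rightarrow> real"
  assumes x: "\<And>v. x v = c * (v - 1 / v)"
    and "u > 0" "s > 1" and q: "q = s\<^sup>2" and c: "c\<^sup>2 * (s\<^sup>2 - 1) = 1"
  shows "s ^ k * (q_hermite k (x (u * s)) q + u\<^sup>2 * q_hermite k (x (u / s)) q)
      = (1 + u\<^sup>2) * q_hermite k (x u) q
    \<and> s ^ k * c * u * (q_hermite k (x (u * s)) q - q_hermite k (x (u / s)) q)
      = (1 + u\<^sup>2) * q_bracket k q * q_hermite (k - 1) (x u) q"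
proof (induction k rule: less_induct)
  case (less n)
  show ?case
  proof (cases n)
    case 0
    then show ?thesis by simp
  next
    case (Suc k)
    define A B h A' B' h' h'' b b'
      where defs: "A = q_hermite k (x (u * s)) q" "B = q_hermite k (x (u / s)) q"
        "h = q_hermite k (x u) q"
        "A' = q_hermite (k - 1) (x (u * s)) q" "B' = q_hermite (k - 1) (x (u / s)) q"
        "h' = q_hermite (k - 1) (x u) q" "h'' = q_hermite (k - 1 - 1) (x u) q"
        "b = q_bracket k q" "b' = q_bracket (k - 1) q"
    have T: "s ^ k * (A + u\<^sup>2 * B) = (1 + u\<^sup>2) * h"
      and D: "s ^ k * c * u * (A - B) = (1 + u\<^sup>2) * b * h'"
      using less.IH[of k] Suc unfolding defs by auto
    \<comment> \<open>The hypothesis for \<open>k - 1\<close> exists only if \<open>k > 0\<close>;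
      the factor \<open>b\<close>, zero at \<open>k = 0\<close>, covers the other case. The same
      holds for \<open>D'\<close> and \<open>h\<close>.\<close>
    have T': "b * s ^ Suc k * (A' + u\<^sup>2 * B') = b * s\<^sup>2 * ((1 + u\<^sup>2) * h')"
    proof (cases k)
      case (Suc l)
      have "s ^ l * (A' + u\<^sup>2 * B') = (1 + u\<^sup>2) * h'"
        using less.IH[of l] Suc \<open>n = _\<close> unfolding defs by auto
      from this[symmetric] show ?thesis
        using Suc by (simp only: power2_eq_square power_Suc mult_ac)
    qed (simp add: defs)
    have D': "b * s ^ Suc k * c * u * (A' - B') = b * s\<^sup>2 * ((1 + u\<^sup>2) * b' * h'')"
    proof (cases k)
      case (Suc l)
      have "s ^ l * c * u * (A' - B') = (1 + u\<^sup>2) * b' * h''"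
        using less.IH[of l] Suc \<open>n = _\<close> unfolding defs by auto
      from this[symmetric] show ?thesis
        using Suc by (simp only: power2_eq_square power_Suc mult_ac)
    qed (simp add: defs)
    have h: "b * h = b * (x u * h' - b' * h'')"
      by (cases k) (auto simp: defs q_hermite_Suc)
    \<comment> \<open>From \<open>s * x (u * s) = x u + c (s^2 - 1) u\<close> and
      \<open>s * x (u / s) = x u - c (s^2 - 1) / u\<close>. Multiplication by the point mixes
      weighted sum and difference, so neither identity closes alone.\<close>
    have Tx: "s * (x (u * s) * A + u\<^sup>2 * (x (u / s) * B))
        = x u * (A + u\<^sup>2 * B) + c * (s\<^sup>2 - 1) * u * (A - B)"
      and Dx: "s * u * (x (u * s) * A - x (u / s) * B)
        = s\<^sup>2 * x u * u * (A - B) + c * (s\<^sup>2 - 1) * (A + u\<^sup>2 * B)"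
      using \<open>u > 0\<close> \<open>s > 1\<close> unfolding x by (simp_all add: field_simps power2_eq_square)
    have "s ^ n * ((x (u * s) * A - b * A') + u\<^sup>2 * (x (u / s) * B - b * B'))
        = s ^ k * (s * (x (u * s) * A + u\<^sup>2 * (x (u / s) * B))) - b * s ^ Suc k * (A' + u\<^sup>2 * B')"
      unfolding Suc by (simp add: algebra_simps)
    also have "\<dots> = x u * (s ^ k * (A + u\<^sup>2 * B)) + (s\<^sup>2 - 1) * (s ^ k * c * u * (A - B))
        - b * s ^ Suc k * (A' + u\<^sup>2 * B')"
      unfolding Tx by (simp add: algebra_simps)
    also have "\<dots> = (1 + u\<^sup>2) * (x u * h - b * h')"
      unfolding T D T' by (simp add: algebra_simps)
    finally have 1: "s ^ n * ((x (u * s) * A - b * A') + u\<^sup>2 * (x (u / s) * B - b * B'))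
        = (1 + u\<^sup>2) * (x u * h - b * h')" .
    have "s ^ n * c * u * ((x (u * s) * A - b * A') - (x (u / s) * B - b * B'))
        = s ^ k * c * (s * u * (x (u * s) * A - x (u / s) * B))
          - b * s ^ Suc k * c * u * (A' - B')"
      unfolding Suc by (simp add: algebra_simps)
    \<comment> \<open>The normalisation \<open>c^2 (s^2 - 1) = 1\<close> makes the weighted sum
      contribute exactly one \<open>h\<close>, the summand 1 in
      \<open>[k+1] = 1 + q [k]\<close>.\<close>
    also have "\<dots> = s\<^sup>2 * x u * (s ^ k * c * u * (A - B))
        + (c\<^sup>2 * (s\<^sup>2 - 1)) * (s ^ k * (A + u\<^sup>2 * B)) - b * s ^ Suc k * c * u * (A' - B')"
      unfolding Dx by (simp add: algebra_simps power2_eq_square)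
    also have "\<dots> = (1 + u\<^sup>2) * (q * (b * (x u * h' - b' * h'')) + h)"
      unfolding T D D' c q by (simp add: algebra_simps)
    also have "\<dots> = (1 + u\<^sup>2) * (1 + q * b) * h"
      unfolding h[symmetric] by (simp add: algebra_simps)
    finally have 2: "s ^ n * c * u * ((x (u * s) * A - b * A') - (x (u / s) * B - b * B'))
        = (1 + u\<^sup>2) * (1 + q * b) * h" .
    show ?thesis
      using 1 2 unfolding Suc q_hermite_Suc q_bracket_Suc diff_Suc_1 defs by blast
  qed
qed

section \<open>Eigenfunctions of the walk and vanishing expectations\<close>

lemma expectation_chi_walk:
  fixes f :: "real \<Rightarrow> real"
  assumes "q > 1"
  shows "measure_pmf.expectation (chi_walk q y) f
    = up_prob y q * f (chi 1 y q) + (1 - up_prob y q) * f (chi (-1) y q)"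
  using up_prob_bounds[OF assms] by (simp add: chi_walk_def)

lemma expectation_q_hermite_chi_walk:
  assumes "q > 1"
  shows "measure_pmf.expectation (chi_walk q y) (\<lambda>z. q_hermite k z q)
    = (q powr (- 1 / 2)) ^ k * q_hermite k y q"
proof -
  obtain u where u: "u > 0" "y = (u - 1 / u) / sqrt (q - 1)"
    using param_exists[OF assms] by blast
  define s where "s = sqrt q"
  define x where "x = (\<lambda>v::real. (1 / sqrt (q - 1)) * (v - 1 / v))"
  have s: "s > 1" "q = s\<^sup>2" "q powr (1 / 2) = s" "q powr (- 1 / 2) = 1 / s"
    using assms by (simp_all add: s_def powr_half_sqrt powr_minus_divide)
  have c: "(1 / sqrt (q - 1))\<^sup>2 * (s\<^sup>2 - 1) = 1"
    using assms by (simp add: s_def power_divide)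
  have up: "chi 1 y q = x (u * s)" and down: "chi (-1) y q = x (u / s)" and y: "y = x u"
    using chi_param(1)[OF assms u(1), of 1] chi_param(1)[OF assms u(1), of "-1"] s
    by (simp_all add: x_def u(2))
  have p: "up_prob y q = 1 / (1 + u\<^sup>2)" "1 - up_prob y q = u\<^sup>2 / (1 + u\<^sup>2)"
  proof -
    have "1 + u\<^sup>2 \<noteq> 0" by (simp add: add_nonneg_eq_0_iff)
    then show "up_prob y q = 1 / (1 + u\<^sup>2)" "1 - up_prob y q = u\<^sup>2 / (1 + u\<^sup>2)"
      unfolding u(2) up_prob_param[OF assms u(1)] by (simp_all add: field_simps)
  qed
  have "s ^ k * (q_hermite k (x (u * s)) q + u\<^sup>2 * q_hermite k (x (u / s)) q)
      = (1 + u\<^sup>2) * q_hermite k y q"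
    unfolding y using q_hermite_step_aux[OF _ u(1) s(1,2) c, of x k] by (simp add: x_def)
  moreover have "1 + u\<^sup>2 > 0" "s ^ k > 0" using s(1) by (simp_all add: add_pos_nonneg)
  ultimately have "(q_hermite k (x (u * s)) q + u\<^sup>2 * q_hermite k (x (u / s)) q) / (1 + u\<^sup>2)
      = (1 / s) ^ k * q_hermite k y q"
    using s(1) by (simp add: divide_eq_eq power_one_over eq_divide_eq mult_ac)
  then show ?thesis
    unfolding expectation_chi_walk[OF assms] p(2) up down
    unfolding p(1) s(4)
    by (simp add: add_divide_distrib)
qed

lemma finite_set_step_chi_walk: "finite (set_pmf (step_pmf (chi_walk q) n y))"
  by (induction n) (simp_all add: chi_walk_def)

text \<open>\<open>q_hermite k\<close> is an eigenfunction of the one-step kernel, so each step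
  contributes one eigenvalue; finite support reduces the integrals to finite sums.\<close>

lemma expectation_q_hermite_step_chi_walk:
  assumes "q > 1"
  shows "measure_pmf.expectation (step_pmf (chi_walk q) n y) (\<lambda>z. q_hermite k z q)
    = (q powr (- real n / 2)) ^ k * q_hermite k y q"
proof (induction n)
  case 0
  show ?case using assms by simp
next
  case (Suc n)
  have "measure_pmf.expectation (step_pmf (chi_walk q) (Suc n) y) (\<lambda>z. q_hermite k z q)
      = (\<Sum>a\<in>set_pmf (step_pmf (chi_walk q) n y). pmf (step_pmf (chi_walk q) n y) a *\<^sub>R
          ((q powr (- 1 / 2)) ^ k * q_hermite k a q))"
    unfolding step_pmf.simps expectation_q_hermite_chi_walk[OF assms, symmetric]
    by (rule pmf_expectation_bind) (auto simp: finite_set_step_chi_walk chi_walk_def)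
  also have "\<dots> = (q powr (- 1 / 2)) ^ k
      * measure_pmf.expectation (step_pmf (chi_walk q) n y) (\<lambda>z. q_hermite k z q)"
    by (subst integral_measure_pmf_real[OF finite_set_step_chi_walk])
      (auto simp: sum_distrib_left mult_ac)
  also have "\<dots> = (q powr (- 1 / 2) * q powr (- real n / 2)) ^ k * q_hermite k y q"
    unfolding Suc by (simp add: power_mult_distrib)
  also have "q powr (- 1 / 2) * q powr (- real n / 2) = q powr (- real (Suc n) / 2)"
    by (simp add: powr_add[symmetric] add_divide_distrib diff_divide_distrib)
  finally show ?case .
qed

lemma expectation_asc_poly_step_chi_walk:
  assumes "q > 1" "j \<ge> 1"
  shows "measure_pmf.expectation (step_pmf (chi_walk q) n y)
      (\<lambda>z. asc_poly j z y (q powr (- real n / 2)) q) = 0"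
proof -
  define r where "r = q powr (- real n / 2)"
  have "measure_pmf.expectation (step_pmf (chi_walk q) n y) (\<lambda>z. asc_poly j z y r q)
      = (\<Sum>k\<le>j. asc_coeff j k y q * r ^ (j - k) *
          measure_pmf.expectation (step_pmf (chi_walk q) n y) (\<lambda>z. q_hermite k z q))"
    unfolding asc_poly_expansion
    by (simp add: integrable_measure_pmf_finite finite_set_step_chi_walk)
  \<comment> \<open>The weight \<open>r ^ (j - k)\<close> and the eigenvalue \<open>r ^ k\<close>
    multiply to \<open>r ^ j\<close> for every \<open>k\<close>, which leaves the expansion at
    \<open>\<rho> = 1\<close>.\<close>
  also have "\<dots> = (\<Sum>k\<le>j. r ^ j * (asc_coeff j k y q * 1 ^ (j - k) * q_hermite k y q))"
    unfolding expectation_q_hermite_step_chi_walk[OF assms(1)] r_def[symmetric]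
    by (intro sum.cong) (auto simp: power_add[symmetric])
  also have "\<dots> = r ^ j * asc_poly j y y 1 q"
    unfolding sum_distrib_left[symmetric] asc_poly_expansion[symmetric] ..
  finally show ?thesis
    using asc_poly_diagonal[OF assms(2)] by (simp add: r_def)
qed

subsection \<open>Identification of the masses\<close>

text \<open>Provides one test polynomial in each degree: the linear factor raises the degree by one
  and the subtracted term stays below it.\<close>

lemma asc_poly_is_poly:
  "\<exists>P. degree P = n \<and> (\<forall>x. poly P x = asc_poly n x y \<rho> q)"
proof (induction n rule: less_induct)
  case (less n)
  consider "n = 0" | "n = 1" | n' where "n = Suc (Suc n')"
    by (metis One_nat_def not0_implies_Suc)
  then show ?case
  proof cases
    case 1
    then show ?thesis by (intro exI[of _ 1]) simp
  next
    case 2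
    then show ?thesis by (intro exI[of _ "[:- (\<rho> * y), 1:]"]) simp
  next
    case 3
    obtain P R where P: "degree P = Suc n'" "\<And>x. poly P x = asc_poly (Suc n') x y \<rho> q"
      and R: "degree R = n'" "\<And>x. poly R x = asc_poly n' x y \<rho> q"
      using less.IH[of "Suc n'"] less.IH[of n'] 3 by auto
    let ?L = "[:- (\<rho> * y * q ^ Suc n'), 1:] * P"
    let ?S = "smult ((1 - \<rho>\<^sup>2 * q ^ n') * q_bracket (Suc n') q) R"
    have L: "degree ?L = n"
      using P 3 by (subst degree_mult_eq) auto
    have "degree ?S < n"
      using R(1) 3 degree_smult_le[of "(1 - \<rho>\<^sup>2 * q ^ n') * q_bracket (Suc n') q" R] by simp
    then have "degree (?L - ?S) = n"
      using L degree_add_eq_left[of "- ?S" ?L] by simp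
    then show ?thesis
      using P(2) R(2) 3 by (intro exI[of _ "?L - ?S"]) (simp add: algebra_simps)
  qed
qed

text \<open>Strong induction on the degree: subtracting a multiple of the basis element of equal
  degree kills the leading coefficient.\<close>

lemma poly_sum_zero_of_graded_basis:
  fixes d x :: "'a \<Rightarrow> 'b::field" and P :: "'b poly"
  assumes basis: "\<And>j. j < n \<Longrightarrow> \<exists>R. degree R = j \<and> (\<Sum>i\<in>A. d i * poly R (x i)) = 0"
    and one: "n > 0 \<Longrightarrow> (\<Sum>i\<in>A. d i) = 0"
    and "degree P < n"
  shows "(\<Sum>i\<in>A. d i * poly P (x i)) = 0"
  using \<open>degree P < n\<close>
proof (induction "degree P" arbitrary: P rule: less_induct)
  case less
  show ?case
  proof (cases "degree P = 0")
    case True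
    then obtain a where "P = [:a:]" by (rule degree_eq_zeroE)
    moreover have "(\<Sum>i\<in>A. d i * a) = 0"
      using one less.prems by (simp add: sum_distrib_right[symmetric])
    ultimately show ?thesis by simp
  next
    case False
    obtain R where R: "degree R = degree P" "(\<Sum>i\<in>A. d i * poly R (x i)) = 0"
      using basis less.prems by blast
    define a where "a = lead_coeff P / lead_coeff R"
    have "lead_coeff R \<noteq> 0" using R(1) False by (metis degree_0 leading_coeff_0_iff)
    then have "coeff (P - smult a R) (degree P) = 0"
      using R(1) by (simp add: a_def)
    moreover have "degree (P - smult a R) \<le> degree P"
      using R(1) by (metis degree_diff_le degree_smult_le order_refl)
    ultimately have "degree (P - smult a R) < degree P"
      using False by (metis eq_zero_or_degree_less degree_0 neq0_conv)
    then have "(\<Sum>i\<in>A. d i * poly (P - smult a R) (x i)) = 0"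
      using less.hyps[of "P - smult a R"] less.prems by simp
    moreover have "(\<Sum>i\<in>A. d i * poly (P - smult a R) (x i))
        = (\<Sum>i\<in>A. d i * poly P (x i)) - a * (\<Sum>i\<in>A. d i * poly R (x i))"
      by (simp add: sum_distrib_left sum_subtractf[symmetric] algebra_simps)
    ultimately show ?thesis using R(2) by simp
  qed
qed

lemma weights_eq_0_of_poly_sums:
  fixes d x :: "'a \<Rightarrow> 'b::field"
  assumes "finite A" "inj_on x A"
    and sums: "\<And>P. degree P < card A \<Longrightarrow> (\<Sum>i\<in>A. d i * poly P (x i)) = 0"
    and "k \<in> A"
  shows "d k = 0"
proof -
  \<comment> \<open>The unnormalised Lagrange polynomial at node \<open>x k\<close>; its degree is
    \<open>card A - 1\<close>.\<close>
  define P where "P = (\<Prod>i\<in>A - {k}. [:- x i, 1:])"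
  have "degree P = card (A - {k})"
    unfolding P_def by (subst degree_prod_eq_sum_degree) auto
  then have "degree P < card A"
    using assms by (metis card_Diff1_less)
  then have "0 = (\<Sum>i\<in>A. d i * poly P (x i))" by (simp add: sums)
  also have "\<dots> = (\<Sum>i\<in>A. if i = k then d k * poly P (x k) else 0)"
    using \<open>finite A\<close> by (intro sum.cong) (auto simp: P_def poly_prod)
  also have "\<dots> = d k * poly P (x k)"
    using assms by simp
  finally have "d k * poly P (x k) = 0" by simp
  moreover have "poly P (x k) \<noteq> 0"
    using assms by (auto simp: P_def poly_prod inj_on_def)
  ultimately show ?thesis by simp
qed

section \<open>Existence and uniqueness of the masses\<close>

lemma index_set_Suc: "index_set (Suc n) = (\<lambda>k. 2 * int k - int n) ` {..n}"
proof (intro equalityI subsetI)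
  fix i assume "i \<in> index_set (Suc n)"
  then have i: "\<bar>i\<bar> \<le> int n" "even (i - int n)" by (simp_all add: index_set_def)
  then have "even (i + int n)" by simp
  with i(1) have "i = 2 * int (nat ((i + int n) div 2)) - int n" "nat ((i + int n) div 2) \<le> n"
    by auto
  then show "i \<in> (\<lambda>k. 2 * int k - int n) ` {..n}" by blast
qed (auto simp: index_set_def)

lemma finite_index_set: "finite (index_set (Suc n))"
  and card_index_set: "card (index_set (Suc n)) = Suc n"
  unfolding index_set_Suc by (auto simp: card_image inj_on_def)

text \<open>For \<open>m = n + 1\<close> the parameter \<open>q^(-(m-1)/2)\<close> is
  \<open>q^(-n/2)\<close>, just the \<open>\<rho>\<close> at which the \<open>n\<close>-step
  expectations vanish.\<close>

lemma mass_system_index_walk: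
  assumes "q > 1"
  shows "mass_system (Suc n) y q (pmf (index_walk n y q))"
  unfolding mass_system_def
proof (intro conjI allI impI ballI)
  fix i assume "i \<notin> index_set (Suc n)"
  then show "pmf (index_walk n y q) i = 0"
    using set_index_walk by (metis pmf_eq_0_set_pmf subsetD)
next
  show "(\<Sum>i\<in>index_set (Suc n). pmf (index_walk n y q) i) = 1"
    by (rule sum_pmf_eq_1[OF finite_index_set set_index_walk])
next
  fix j assume "j \<in> {1..Suc n - 1}"
  then have "0 = measure_pmf.expectation (index_walk n y q)
      (\<lambda>i. asc_poly j (chi i y q) y (q powr (- real n / 2)) q)"
    using expectation_asc_poly_step_chi_walk[OF assms, of j n y] step_chi_walk[OF assms] by simp
  also have "\<dots> = (\<Sum>i\<in>index_set (Suc n). asc_poly j (chi i y q) y (q powr (- real n / 2)) q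
      * pmf (index_walk n y q) i)"
    by (rule integral_measure_pmf_real[OF finite_index_set]) (use set_index_walk in auto)
  finally show "(\<Sum>i\<in>index_set (Suc n). pmf (index_walk n y q) i
      * asc_poly j (chi i y q) y (q powr (- (real (Suc n) - 1) / 2)) q) = 0"
    by (simp add: mult.commute)
qed

lemma mass_system_unique:
  assumes "q > 1" "mass_system (Suc n) y q l" "mass_system (Suc n) y q l'"
  shows "l = l'"
proof
  fix i
  let ?A = "index_set (Suc n)"
  show "l i = l' i"
  proof (cases "i \<in> ?A")
    case True
    \<comment> \<open>The difference annihilates one polynomial of each degree up to
      \<open>n\<close>: degree 0 by total mass, the others by the moment equations. With
      \<open>n + 1\<close> distinct nodes this forces \<open>d = 0\<close>.\<close>
    define d where "d = (\<lambda>i. l i - l' i)"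
    have one: "(\<Sum>i\<in>?A. d i) = 0"
      using assms(2,3) by (simp add: mass_system_def d_def sum_subtractf)
    have basis: "\<exists>R. degree R = j \<and> (\<Sum>i\<in>?A. d i * poly R (chi i y q)) = 0" if "j < Suc n" for j
    proof -
      obtain R where R: "degree R = j"
        "\<And>x. poly R x = asc_poly j x y (q powr (- (real (Suc n) - 1) / 2)) q"
        using asc_poly_is_poly by blast
      have "(\<Sum>i\<in>?A. d i * poly R (chi i y q)) = 0"
      proof (cases "j = 0")
        case True
        then show ?thesis using one by (simp add: R(2))
      next
        case False
        then show ?thesis
          using assms(2,3) that
          by (simp add: mass_system_def R(2) d_def left_diff_distrib sum_subtractf)
      qed
      then show ?thesis using R(1) by blast
    qed
    have "d i = 0"
    proof (rule weights_eq_0_of_poly_sums[OF finite_index_set _ _ True])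
      show "inj_on (\<lambda>i. chi i y q) ?A"
        using inj_chi[OF assms(1)] by (rule inj_on_subset) simp
      show "(\<Sum>i\<in>?A. d i * poly P (chi i y q)) = 0" if "degree P < card ?A" for P
        using poly_sum_zero_of_graded_basis[OF basis one] that by (simp add: card_index_set)
    qed
    then show ?thesis by (simp add: d_def)
  next
    case False
    then show ?thesis using assms(2,3) by (simp add: mass_system_def)
  qed
qed

text \<open>Uniqueness resolves the description operator. The solution found is already a
  \<open>pmf\<close>, so nonnegativity is automatic and \<open>embed_pmf\<close> recovers the
  walk.\<close>

lemma Lambda_Suc:
  assumes "q > 1"
  shows "Lambda (Suc n) y q = step_pmf (chi_walk q) n y"
proof -
  have "mass (Suc n) y q = pmf (index_walk n y q)"
    unfolding mass_def
    using mass_system_index_walk[OF assms] mass_system_unique[OF assms] by (intro the_equality) blast+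
  then have "embed_pmf (mass (Suc n) y q) = index_walk n y q"
    by (simp add: type_definition.Rep_inverse[OF td_pmf_embed_pmf])
  then show ?thesis
    by (simp add: Lambda_def step_chi_walk[OF assms])
qed

theorem theorem1:
  fixes m :: nat and q :: real
  assumes "m \<ge> 2" and "q > 1"
  shows "(\<forall>k::nat. k \<ge> 1 \<longrightarrow>
            (\<forall>y::real. step_pmf (\<lambda>z. Lambda m z q) k y = Lambda (k * m - k + 1) y q))
       \<and> (\<forall>(k::nat) (j::nat) (x::real). k \<ge> 1 \<longrightarrow> j \<ge> 1 \<longrightarrow>
            bind_pmf (Lambda (k * m - k + 1) x q) (\<lambda>y. Lambda (j * m - j + 1) y q)
              = Lambda ((k + j) * m - (k + j) + 1) x q)"
proof -
  let ?K = "chi_walk q"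
  \<comment> \<open>\<open>Lambda m\<close> is \<open>m - 1\<close> steps of the base walk, so all
    indices are counted in those steps.\<close>
  have index: "k * m - k + 1 = Suc (k * (m - 1))" for k
    by (simp add: right_diff_distrib')
  have "(\<lambda>z. Lambda m z q) = step_pmf ?K (m - 1)"
    using Lambda_Suc[OF assms(2), of "m - 1"] assms(1) by (simp add: fun_eq_iff)
  then have "step_pmf (\<lambda>z. Lambda m z q) k y = Lambda (k * m - k + 1) y q" for k y
    unfolding index Lambda_Suc[OF assms(2)] by (simp add: step_pmf_mult)
  moreover have "bind_pmf (Lambda (k * m - k + 1) x q) (\<lambda>y. Lambda (j * m - j + 1) y q)
      = Lambda ((k + j) * m - (k + j) + 1) x q" for k j x
    unfolding index Lambda_Suc[OF assms(2)] by (simp add: step_pmf_add distrib_right)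
  ultimately show ?thesis by blast
qed

end
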